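(* Let $\Phi:F^\infty\to B(\mathcal F^2(\mathcal H_n))$ be defined by $\Phi(\varphi)=\varphi(S_1,\dots,S_n)$. Then: (i) $\Phi$ is an algebra homomorphism; (ii) $\|\Phi(\psi)\|=\|\psi\|_\infty$ for every $\psi\in F^\infty$; (iii) $\psi\in F^\infty$ is invertible in $F^\infty$ if and only if $\Phi(\psi)$ is invertible in $B(\mathcal F^2(\mathcal H_n))$.
   Context: Fix an integer $n\ge 1$ and $\Lambda=\{1,\dots,n\}$. Let $\mathcal F$ be the set of all finite words in $\Lambda$, i.e. functions $f:\{1,\dots,k\}\to\Lambda$, $k\ge 0$, the empty word being denoted $0$. The full Fock space $\mathcal F^2(\mathcal H_n)$ is the complex Hilbert space with orthonormal basis $\{e_f: f\in\mathcal F\}$, where $e_0=1$ and $e_f=e_{f(1)}\otimes\cdots\otimes e_{f(k)}$. The product $\otimes$ is the bilinear extension of concatenation of words: $\langle \varphi\otimes\psi,e_h\rangle=\sum_{e_f\otimes e_g=e_h}\langle\varphi,e_f\rangle\langle\psi,e_g\rangle$ (a finite sum; in general $\varphi\otimes\psi$ is a formal series). $\mathcal P=\mathrm{span}\{e_f:f\in\mathcal F\}$ is the set of polynomials. $\|\cdot\|_2$ is the norm of $\mathcal F^2(\mathcal H_n)$. $F^\infty$ is the set of all $g\in\mathcal F^2(\mathcal H_n)$ with $\|g\|_\infty=\sup\{\|g\otimes p\|_2: p\in\mathcal P,\ \|p\|_2\le 1\}<\infty$; it is a unital Banach algebra under $\otimes$ with unit $e_0=1$. For $\varphi\in F^\infty$,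 $\varphi(S_1,\dots,S_n)$ denotes the bounded operator on $\mathcal F^2(\mathcal H_n)$ given by $\varphi(S_1,\dots,S_n)\psi=\varphi\otimes\psi$ (so that $S_i\psi=e_i\otimes\psi$). *)

theory Defs
  imports "HOL-Analysis.Analysis" "HOL-Algebra.Module"
begin

section \<open>Formal series over words\<close>

text \<open>
  The alphabet is the type \<open>'n\<close>, instantiated to a type of class \<^class>\<open>finite\<close> in the main
  theorem; so the number of letters is \<open>CARD('n)\<close>, an arbitrary positive integer.  A word is a
  list of letters, the empty word is \<open>[]\<close>, and a formal series is the family of its coefficients.
\<close>

definition square_summable :: "('n list \<Rightarrow> complex) \<Rightarrow> bool" where
  "square_summable f \<longleftrightarrow> (\<lambda>w. (cmod (f w))\<^sup>2) summable_on UNIV"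

definition l2norm :: "('n list \<Rightarrow> complex) \<Rightarrow> real" where
  "l2norm f = sqrt (\<Sum>\<^sub>\<infinity>w. (cmod (f w))\<^sup>2)"

definition series_tensor ::
    "('n list \<Rightarrow> complex) \<Rightarrow> ('n list \<Rightarrow> complex) \<Rightarrow> 'n list \<Rightarrow> complex" where
  "series_tensor \<phi> \<psi> h = (\<Sum>(f, g) \<in> {(f, g). f @ g = h}. \<phi> f * \<psi> g)"

lemma finite_splits: "finite {(f, g). f @ g = h}"
proof (rule finite_subset)
  show "{(f, g). f @ g = h} \<subseteq> (\<lambda>k. (take k h, drop k h)) ` {..length h}"
  proof safe
    fix f g assume "h = f @ g"
    then show "(f, g) \<in> (\<lambda>k. (take k (f @ g), drop k (f @ g))) ` {..length (f @ g)}"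
      by (intro image_eqI[of _ _ "length f"]) auto
  qed
qed auto

lemma square_summableI:
  assumes "\<And>A. finite A \<Longrightarrow> L2_set (\<lambda>w. cmod (f w)) A \<le> C"
  shows "square_summable f" and "l2norm f \<le> C"
proof -
  have C0: "C \<ge> 0" using assms[of "{}"] by simp
  have *: "(\<Sum>w\<in>A. (cmod (f w))\<^sup>2) \<le> C\<^sup>2" if "finite A" for A
    using assms[OF that] C0 unfolding L2_set_def by (metis real_sqrt_le_iff real_sqrt_abs abs_of_nonneg)
  show s: "square_summable f"
    unfolding square_summable_def
    by (rule nonneg_bdd_above_summable_on) (auto intro!: bdd_aboveI2[where M="C\<^sup>2"] *)
  have "(\<Sum>\<^sub>\<infinity>w. (cmod (f w))\<^sup>2) \<le> C\<^sup>2"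
    by (rule infsum_le_finite_sums) (use s * in \<open>auto simp: square_summable_def\<close>)
  then show "l2norm f \<le> C"
    unfolding l2norm_def using C0 by (metis real_sqrt_le_iff real_sqrt_abs abs_of_nonneg)
qed

lemma L2_set_le_l2norm:
  assumes "square_summable f" "finite A"
  shows "L2_set (\<lambda>w. cmod (f w)) A \<le> l2norm f"
  unfolding L2_set_def l2norm_def
  by (intro real_sqrt_le_mono finite_sum_le_infsum) (use assms in \<open>auto simp: square_summable_def\<close>)

lemma square_summable_add:
  assumes "square_summable f" "square_summable g"
  shows "square_summable (\<lambda>w. f w + g w)" and "l2norm (\<lambda>w. f w + g w) \<le> l2norm f + l2norm g"
proof -
  have "L2_set (\<lambda>w. cmod (f w + g w)) A \<le> l2norm f + l2norm g" if "finite A" for A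
  proof -
    have "L2_set (\<lambda>w. cmod (f w + g w)) A \<le> L2_set (\<lambda>w. cmod (f w) + cmod (g w)) A"
      by (rule L2_set_mono) (auto intro: norm_triangle_ineq)
    also have "\<dots> \<le> L2_set (\<lambda>w. cmod (f w)) A + L2_set (\<lambda>w. cmod (g w)) A"
      by (rule L2_set_triangle_ineq)
    also have "\<dots> \<le> l2norm f + l2norm g"
      by (intro add_mono L2_set_le_l2norm assms that)
    finally show ?thesis .
  qed
  from square_summableI[OF this]
  show "square_summable (\<lambda>w. f w + g w)" and "l2norm (\<lambda>w. f w + g w) \<le> l2norm f + l2norm g"
    by auto
qed

lemma square_summable_scale:
  "square_summable f \<Longrightarrow> square_summable (\<lambda>w. c * f w)"
  unfolding square_summable_def by (simp add: norm_mult power_mult_distrib summable_on_cmult_right)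

lemma l2norm_scale: "l2norm (\<lambda>w. c * f w) = cmod c * l2norm f"
  unfolding l2norm_def
  by (simp add: norm_mult power_mult_distrib infsum_cmult_right' real_sqrt_mult)

lemma square_summable_zero: "square_summable (\<lambda>w. 0)"
  by (simp add: square_summable_def)


section \<open>The full Fock space\<close>

text \<open>
  The Hilbert space with orthonormal basis indexed by the words is realised as the space of square
  summable families; \<open>coeff \<phi> w\<close> is the inner product of \<open>\<phi>\<close> with the basis vector of \<open>w\<close>.
\<close>

typedef 'n fock = "{f :: 'n list \<Rightarrow> complex. square_summable f}"
  morphisms coeff Abs_fock
  using square_summable_zero by blast

setup_lifting type_definition_fock

lemma square_summable_coeff: "square_summable (coeff \<phi>)"
  using coeff by auto

lemma fock_eqI: "(\<And>w. coeff x w = coeff y w) \<Longrightarrow> x = y"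
  by (metis coeff_inject ext)

lift_definition scaleC :: "complex \<Rightarrow> 'n fock \<Rightarrow> 'n fock" (infixr \<open>*\<^sub>C\<close> 75)
  is "\<lambda>c f w. c * f w"
  by (rule square_summable_scale)

instantiation fock :: (type) real_normed_vector
begin

lift_definition zero_fock :: "'a fock" is "\<lambda>w. 0" by (rule square_summable_zero)
lift_definition plus_fock :: "'a fock \<Rightarrow> 'a fock \<Rightarrow> 'a fock" is "\<lambda>f g w. f w + g w"
  by (rule square_summable_add)
lift_definition uminus_fock :: "'a fock \<Rightarrow> 'a fock" is "\<lambda>f w. - f w"
  by (simp add: square_summable_def)
lift_definition minus_fock :: "'a fock \<Rightarrow> 'a fock \<Rightarrow> 'a fock" is "\<lambda>f g w. f w - g w"
proof -
  fix f g :: "'a list \<Rightarrow> complex" assume "square_summable f" "square_summable g"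
  then show "square_summable (\<lambda>w. f w - g w)"
    using square_summable_add(1)[of f "\<lambda>w. - g w"] by (simp add: square_summable_def)
qed
lift_definition scaleR_fock :: "real \<Rightarrow> 'a fock \<Rightarrow> 'a fock" is "\<lambda>r f w. of_real r * f w"
  by (rule square_summable_scale)
lift_definition norm_fock :: "'a fock \<Rightarrow> real" is l2norm .

definition "sgn (x :: 'a fock) = scaleR (inverse (norm x)) x"
definition "dist (x :: 'a fock) y = norm (x - y)"
definition [code del]:
  "(uniformity :: ('a fock \<times> 'a fock) filter) = (INF e\<in>{0<..}. principal {(x, y). dist x y < e})"
definition [code del]:
  "open (U :: 'a fock set) \<longleftrightarrow> (\<forall>x\<in>U. eventually (\<lambda>(x', y). x' = x \<longrightarrow> y \<in> U) uniformity)"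

instance
proof
  fix x y z :: "'a fock" and a b :: real
  show "x + y + z = x + (y + z)" "x + y = y + x" "0 + x = x" "- x + x = 0" "x - y = x + - y"
    by (transfer; simp add: add_ac fun_eq_iff)+
  show "a *\<^sub>R (x + y) = a *\<^sub>R x + a *\<^sub>R y" "(a + b) *\<^sub>R x = a *\<^sub>R x + b *\<^sub>R x"
    "a *\<^sub>R b *\<^sub>R x = (a * b) *\<^sub>R x" "1 *\<^sub>R x = x"
    by (transfer; simp add: algebra_simps fun_eq_iff)+
  show "norm (x + y) \<le> norm x + norm y"
    by transfer (rule square_summable_add)
  show "norm (a *\<^sub>R x) = \<bar>a\<bar> * norm x"
    by transfer (simp add: l2norm_scale)
  show "norm x = 0 \<longleftrightarrow> x = 0"
  proof
    assume n0: "norm x = 0"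
    have "cmod (coeff x w) \<le> 0" for w
      using L2_set_le_l2norm[OF square_summable_coeff, of "{w}" x] n0
      by (simp add: norm_fock.rep_eq)
    then show "x = 0" by (intro fock_eqI) (simp add: zero_fock.rep_eq)
  next
    assume "x = 0"
    then show "norm x = 0" by (simp add: norm_fock.rep_eq zero_fock.rep_eq l2norm_def)
  qed
qed (rule sgn_fock_def dist_fock_def uniformity_fock_def open_fock_def)+

end

global_interpretation fock: vector_space "scaleC :: complex \<Rightarrow> 'n fock \<Rightarrow> 'n fock"
  by unfold_locales (transfer; simp add: algebra_simps fun_eq_iff)+

text \<open>The real structure and the norm are compatible with the complex structure.\<close>

lemma scaleR_eq_scaleC: "r *\<^sub>R x = complex_of_real r *\<^sub>C (x :: 'n fock)"
  by transfer simp

lemma norm_scaleC: "norm (c *\<^sub>C x) = cmod c * norm x"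
  by transfer (rule l2norm_scale)

lift_definition basis_vec :: "'n list \<Rightarrow> 'n fock" is "\<lambda>f w. if w = f then 1 else 0"
proof -
  fix f :: "'n list"
  have "(\<lambda>w. (cmod (if w = f then 1 else 0))\<^sup>2) summable_on UNIV \<longleftrightarrow>
        (\<lambda>w. (cmod (if w = f then 1 else 0))\<^sup>2) summable_on {f}"
    by (rule summable_on_cong_neutral) auto
  then show "square_summable (\<lambda>w. if w = f then 1 else 0)"
    by (simp add: square_summable_def)
qed

definition polynomials :: "'n fock set" where
  "polynomials = fock.span (range basis_vec)"


section \<open>The product and the algebra F-infinity\<close>

text \<open>
  In general the product of two elements of the Fock space is only a formal series, and this
  function is meaningful only when that series is square summable.  Lemmas
  \<open>coeff_tensor_polynomial\<close> and \<open>coeff_tensor_F_infty\<close> below show that this is so in all uses.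
\<close>

definition tensor :: "'n fock \<Rightarrow> 'n fock \<Rightarrow> 'n fock" (infixl \<open>\<otimes>\<^sub>F\<close> 70) where
  "\<phi> \<otimes>\<^sub>F \<psi> = Abs_fock (series_tensor (coeff \<phi>) (coeff \<psi>))"

definition F_infty :: "'n fock set" where
  "F_infty = {g. bdd_above {norm (g \<otimes>\<^sub>F p) |p. p \<in> polynomials \<and> norm p \<le> 1}}"

definition norm_infty :: "'n fock \<Rightarrow> real" where
  "norm_infty g = Sup {norm (g \<otimes>\<^sub>F p) |p. p \<in> polynomials \<and> norm p \<le> 1}"

definition F_infty_algebra :: "(complex, 'n fock) module" where
  "F_infty_algebra =
    \<lparr> carrier = F_infty, mult = (\<otimes>\<^sub>F), one = basis_vec [],
      zero = 0, add = (+), smult = scaleC \<rparr>"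

text \<open>
  The bounded complex-linear operators.  The operator norm is \<^const>\<open>onorm\<close>, which depends only
  on the norm of the space.
\<close>

definition bounded_operators :: "('n fock \<Rightarrow> 'n fock) set" where
  "bounded_operators = {T. bounded_linear T \<and> Vector_Spaces.linear scaleC scaleC T}"

definition operator_algebra :: "(complex, 'n fock \<Rightarrow> 'n fock) module" where
  "operator_algebra =
    \<lparr> carrier = bounded_operators, mult = (\<circ>), one = id,
      zero = (\<lambda>x. 0), add = (\<lambda>S T x. S x + T x), smult = (\<lambda>c T x. c *\<^sub>C T x) \<rparr>"

definition Phi :: "'n fock \<Rightarrow> ('n fock \<Rightarrow> 'n fock)" where
  "Phi \<phi> = (\<lambda>\<psi>. \<phi> \<otimes>\<^sub>F \<psi>)"

text \<open>An algebra homomorphism is a unital ring homomorphism respecting scalars.\<close>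

definition algebra_hom ::
    "(complex, 'a) module \<Rightarrow> (complex, 'b) module \<Rightarrow> ('a \<Rightarrow> 'b) set" where
  "algebra_hom A B =
    {h \<in> ring_hom A B. \<forall>c. \<forall>x\<in>carrier A. h (c \<odot>\<^bsub>A\<^esub> x) = c \<odot>\<^bsub>B\<^esub> h x}"


section \<open>The product is well defined where it is used\<close>

lemma series_tensor_linear_right:
  "series_tensor \<phi> (\<lambda>w. 0) h = 0"
  "series_tensor \<phi> (\<lambda>w. x w + y w) h = series_tensor \<phi> x h + series_tensor \<phi> y h"
  "series_tensor \<phi> (\<lambda>w. c * x w) h = c * series_tensor \<phi> x h"
  by (simp_all add: series_tensor_def case_prod_unfold sum.distrib sum_distrib_left algebra_simps)

lemma series_tensor_basis:
  "series_tensor \<phi> (coeff (basis_vec f)) (u @ f) = \<phi> u"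
  "h \<notin> range (\<lambda>u. u @ f) \<Longrightarrow> series_tensor \<phi> (coeff (basis_vec f)) h = 0"
proof -
  have "series_tensor \<phi> (coeff (basis_vec f)) (u @ f) = (\<Sum>(a, b)\<in>{(u, f)}. \<phi> a * coeff (basis_vec f) b)"
    unfolding series_tensor_def
  proof (rule sum.mono_neutral_right[OF finite_splits])
    show "\<forall>x\<in>{(a, b). a @ b = u @ f} - {(u, f)}.
        (case x of (a, b) \<Rightarrow> \<phi> a * coeff (basis_vec f) b) = 0"
    proof (intro ballI)
      fix x assume "x \<in> {(a, b). a @ b = u @ f} - {(u, f)}"
      then obtain a b where x: "x = (a, b)" "a @ b = u @ f" "(a, b) \<noteq> (u, f)" by blast
      from x(2,3) have "b \<noteq> f" by (metis append_same_eq)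
      then show "(case x of (a, b) \<Rightarrow> \<phi> a * coeff (basis_vec f) b) = 0"
        by (simp add: x(1) basis_vec.rep_eq)
    qed
  qed simp
  then show "series_tensor \<phi> (coeff (basis_vec f)) (u @ f) = \<phi> u"
    by (simp add: basis_vec.rep_eq)
  show "h \<notin> range (\<lambda>u. u @ f) \<Longrightarrow> series_tensor \<phi> (coeff (basis_vec f)) h = 0"
    unfolding series_tensor_def by (rule sum.neutral) (auto simp: basis_vec.rep_eq)
qed

lemma square_summable_tensor_basis:
  assumes "square_summable \<phi>"
  shows "square_summable (series_tensor \<phi> (coeff (basis_vec f)))"
proof -
  let ?s = "\<lambda>h. (cmod (series_tensor \<phi> (coeff (basis_vec f)) h))\<^sup>2"
  have "?s summable_on UNIV \<longleftrightarrow> ?s summable_on range (\<lambda>u. u @ f)"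
    by (rule summable_on_cong_neutral) (auto simp: series_tensor_basis(2))
  also have "\<dots> \<longleftrightarrow> (?s \<circ> (\<lambda>u. u @ f)) summable_on UNIV"
    by (rule summable_on_reindex) (auto simp: inj_def)
  also have "\<dots>"
    using assms by (simp add: o_def series_tensor_basis(1) square_summable_def)
  finally show ?thesis by (simp add: square_summable_def)
qed

lemma coeff_tensor:
  "square_summable (series_tensor (coeff \<phi>) (coeff \<psi>)) \<Longrightarrow>
   coeff (\<phi> \<otimes>\<^sub>F \<psi>) = series_tensor (coeff \<phi>) (coeff \<psi>)"
  by (simp add: tensor_def Abs_fock_inverse)

lemma square_summable_tensor_polynomial:
  assumes "p \<in> polynomials"
  shows "square_summable (series_tensor (coeff \<phi>) (coeff p))"
  using assms unfolding polynomials_def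
proof (induction rule: fock.span_induct_alt)
  case base
  show ?case
    using square_summable_zero by (simp add: zero_fock.rep_eq series_tensor_linear_right[abs_def])
next
  case (step c x y)
  then have "square_summable (series_tensor (coeff \<phi>) (coeff x))"
    by (auto intro: square_summable_tensor_basis square_summable_coeff)
  from square_summable_add(1)[OF square_summable_scale[OF this] step(2)]
  show ?case
    by (simp add: plus_fock.rep_eq scaleC.rep_eq series_tensor_linear_right[abs_def])
qed

lemma coeff_tensor_polynomial:
  "p \<in> polynomials \<Longrightarrow> coeff (\<phi> \<otimes>\<^sub>F p) = series_tensor (coeff \<phi>) (coeff p)"
  by (intro coeff_tensor square_summable_tensor_polynomial)

lemma norm_tensor_polynomial_le:
  assumes "\<phi> \<in> F_infty" "p \<in> polynomials"
  shows "norm (\<phi> \<otimes>\<^sub>F p) \<le> norm_infty \<phi> * norm p"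
proof (cases "p = 0")
  case True
  have "\<phi> \<otimes>\<^sub>F p = 0"
    using assms(2) True
    by (intro fock_eqI)
      (simp add: coeff_tensor_polynomial zero_fock.rep_eq series_tensor_linear_right)
  then show ?thesis using True by simp
next
  case False
  define c where "c = complex_of_real (inverse (norm p))"
  have q: "c *\<^sub>C p \<in> polynomials"
    using assms(2) unfolding polynomials_def by (rule fock.span_scale)
  have "\<phi> \<otimes>\<^sub>F (c *\<^sub>C p) = c *\<^sub>C (\<phi> \<otimes>\<^sub>F p)"
    using assms(2) q
    by (intro fock_eqI)
      (simp add: coeff_tensor_polynomial scaleC.rep_eq series_tensor_linear_right)
  then have "norm (\<phi> \<otimes>\<^sub>F (c *\<^sub>C p)) = norm (\<phi> \<otimes>\<^sub>F p) / norm p"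
    by (simp add: norm_scaleC c_def norm_inverse divide_inverse)
  moreover have "norm (\<phi> \<otimes>\<^sub>F (c *\<^sub>C p)) \<le> norm_infty \<phi>"
    unfolding norm_infty_def
  proof (rule cSup_upper)
    have "norm (c *\<^sub>C p) \<le> 1"
      using False by (simp add: norm_scaleC c_def norm_inverse)
    with q show "norm (\<phi> \<otimes>\<^sub>F (c *\<^sub>C p)) \<in> {norm (\<phi> \<otimes>\<^sub>F p) |p. p \<in> polynomials \<and> norm p \<le> 1}"
      by blast
  qed (use assms(1) in \<open>simp add: F_infty_def\<close>)
  ultimately show ?thesis
    using False by (simp add: pos_divide_le_eq)
qed

lemma polynomial_truncation:
  assumes "finite B"
  obtains p where "p \<in> polynomials" "\<And>w. w \<in> B \<Longrightarrow> coeff p w = coeff \<psi> w" "norm p \<le> norm \<psi>"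
proof -
  define p where "p = (\<Sum>w\<in>B. coeff \<psi> w *\<^sub>C basis_vec w)"
  have p: "p \<in> polynomials"
    unfolding p_def polynomials_def
    by (intro fock.span_sum fock.span_scale fock.span_base) auto
  have "coeff (\<Sum>w\<in>B'. coeff \<psi> w *\<^sub>C basis_vec w) v = (if v \<in> B' then coeff \<psi> v else 0)"
    if "finite B'" for B' v
    using that
    by (induction B') (auto simp: plus_fock.rep_eq zero_fock.rep_eq scaleC.rep_eq basis_vec.rep_eq)
  then have cp: "coeff p v = (if v \<in> B then coeff \<psi> v else 0)" for v
    using assms by (simp add: p_def)
  have "L2_set (\<lambda>w. cmod (coeff p w)) A \<le> norm \<psi>" if "finite A" for A
  proof -
    have "L2_set (\<lambda>w. cmod (coeff p w)) A \<le> L2_set (\<lambda>w. cmod (coeff \<psi> w)) A"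
      by (rule L2_set_mono) (auto simp: cp)
    also have "\<dots> \<le> norm \<psi>"
      unfolding norm_fock.rep_eq by (rule L2_set_le_l2norm[OF square_summable_coeff that])
    finally show ?thesis .
  qed
  from square_summableI(2)[OF this] have "norm p \<le> norm \<psi>"
    by (simp add: norm_fock.rep_eq)
  with p cp that show ?thesis by simp
qed

lemma square_summable_tensor_F_infty:
  assumes "\<phi> \<in> F_infty"
  shows "square_summable (series_tensor (coeff \<phi>) (coeff \<psi>))"
    and "l2norm (series_tensor (coeff \<phi>) (coeff \<psi>)) \<le> norm_infty \<phi> * norm \<psi>"
proof -
  have "norm (\<phi> \<otimes>\<^sub>F 0) \<in> {norm (\<phi> \<otimes>\<^sub>F p) |p. p \<in> polynomials \<and> norm p \<le> 1}"
  proof (rule CollectI, rule exI[of _ 0], intro conjI)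
    show "0 \<in> polynomials" unfolding polynomials_def by (rule fock.span_zero)
  qed simp_all
  then have "norm (\<phi> \<otimes>\<^sub>F 0) \<le> norm_infty \<phi>"
    unfolding norm_infty_def using assms by (intro cSup_upper) (auto simp: F_infty_def)
  then have nonneg: "norm_infty \<phi> \<ge> 0"
    by (rule order_trans[OF norm_ge_zero])
  have "L2_set (\<lambda>w. cmod (series_tensor (coeff \<phi>) (coeff \<psi>) w)) A \<le> norm_infty \<phi> * norm \<psi>"
    if A: "finite A" for A
  proof -
    have "finite (\<Union>h\<in>A. snd ` {(f, g). f @ g = h})"
      using A by (intro finite_UN_I finite_imageI finite_splits)
    then obtain p where p: "p \<in> polynomials" "norm p \<le> norm \<psi>"
      and eq: "\<And>w. w \<in> (\<Union>h\<in>A. snd ` {(f, g). f @ g = h}) \<Longrightarrow> coeff p w = coeff \<psi> w"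
      by (rule polynomial_truncation[where \<psi> = \<psi>]) blast
    have "series_tensor (coeff \<phi>) (coeff \<psi>) h = coeff (\<phi> \<otimes>\<^sub>F p) h" if "h \<in> A" for h
      unfolding coeff_tensor_polynomial[OF p(1)] series_tensor_def
    proof (rule sum.cong[OF refl], safe)
      fix f g assume "h = f @ g"
      then have "coeff p g = coeff \<psi> g"
        using that by (intro eq UN_I[of h] image_eqI[of _ _ "(f, g)"]) auto
      then show "coeff \<phi> f * coeff \<psi> g = coeff \<phi> f * coeff p g" by simp
    qed
    then have "L2_set (\<lambda>w. cmod (series_tensor (coeff \<phi>) (coeff \<psi>) w)) A
        = L2_set (\<lambda>w. cmod (coeff (\<phi> \<otimes>\<^sub>F p) w)) A"
      by (intro L2_set_cong) auto
    also have "\<dots> \<le> norm (\<phi> \<otimes>\<^sub>F p)"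
      unfolding norm_fock.rep_eq by (rule L2_set_le_l2norm[OF square_summable_coeff A])
    also have "\<dots> \<le> norm_infty \<phi> * norm p"
      by (rule norm_tensor_polynomial_le[OF assms p(1)])
    also have "\<dots> \<le> norm_infty \<phi> * norm \<psi>"
      by (rule mult_left_mono[OF p(2) nonneg])
    finally show ?thesis .
  qed
  from square_summableI[OF this]
  show "square_summable (series_tensor (coeff \<phi>) (coeff \<psi>))"
    and "l2norm (series_tensor (coeff \<phi>) (coeff \<psi>)) \<le> norm_infty \<phi> * norm \<psi>"
    by auto
qed

lemma coeff_tensor_F_infty:
  "\<phi> \<in> F_infty \<Longrightarrow> coeff (\<phi> \<otimes>\<^sub>F \<psi>) = series_tensor (coeff \<phi>) (coeff \<psi>)"
  by (intro coeff_tensor square_summable_tensor_F_infty)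

end

theory Submission
  imports Defs
begin

text \<open>
  Left multiplication by \<open>\<phi> \<in> F_infty\<close> is bounded with constant \<^const>\<open>norm_infty\<close>, and this
  constant is by definition approached on polynomials, so it is the operator norm.  That
  \<^const>\<open>Phi\<close> is multiplicative is the associativity of the product.  Since the coefficients of a
  product are finite sums over the splittings of a word, associativity is a purely combinatorial fact
  about formal series; analysis only enters in deciding which formal series lie in the Fock space.
  The form given in \<open>tensor_assoc\<close> covers two situations: all left factors in \<open>F_infty\<close>, and a
  middle factor that is an arbitrary vector followed by a polynomial.

  The substance of the statement about invertibility is that an inverse \<open>T\<close> of \<open>Phi \<psi>\<close> is again a left
  multiplication.  The only candidate for its symbol is the vector \<open>\<eta> = T 1\<close>, which satisfies
  \<open>\<psi> \<otimes>\<^sub>F \<eta> = 1\<close>.  For a polynomial \<open>p\<close>, both \<open>T p\<close> and \<open>\<eta> \<otimes>\<^sub>F p\<close> are mapped to \<open>p\<close> by the injective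
  operator \<open>Phi \<psi>\<close>, so they agree; the boundedness of \<open>T\<close> thus gives \<open>\<eta> \<in> F_infty\<close>.  Finally
  \<open>\<psi> \<otimes>\<^sub>F (\<eta> \<otimes>\<^sub>F \<psi>) = \<psi> = \<psi> \<otimes>\<^sub>F 1\<close>, and injectivity again shows that the right inverse \<open>\<eta>\<close> is
  two-sided.
\<close>

lemma series_tensor_assoc:
  "series_tensor (series_tensor x y) z = series_tensor x (series_tensor y z)"
proof
  fix h :: "'a list"
  let ?splits = "\<lambda>w :: 'a list. {(f, g). f @ g = w}"
  have "series_tensor (series_tensor x y) z h =
      (\<Sum>s\<in>?splits h. \<Sum>t\<in>?splits (fst s). x (fst t) * y (snd t) * z (snd s))"
    by (simp add: series_tensor_def case_prod_unfold sum_distrib_right)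
  also have "\<dots> = (\<Sum>(s, t)\<in>Sigma (?splits h) (\<lambda>s. ?splits (fst s)).
      x (fst t) * y (snd t) * z (snd s))"
    by (rule sum.Sigma) (auto simp: finite_splits)
  also have "\<dots> = (\<Sum>(s, t)\<in>Sigma (?splits h) (\<lambda>s. ?splits (snd s)).
      x (fst s) * (y (fst t) * z (snd t)))"
    \<comment> \<open>A splitting of \<open>h\<close> into three words \<open>a, b, c\<close> is \<open>((a @ b, c), (a, b))\<close> on the left and
      \<open>((a, b @ c), (b, c))\<close> on the right.\<close>
    by (rule sum.reindex_bij_witness
        [where j = "\<lambda>(s, t). ((fst t, snd t @ snd s), (snd t, snd s))"
           and i = "\<lambda>(s, t). ((fst s @ fst t, snd t), (fst s, fst t))"])
      auto
  also have "\<dots> = (\<Sum>s\<in>?splits h. \<Sum>t\<in>?splits (snd s). x (fst s) * (y (fst t) * z (snd t)))"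
    by (rule sum.Sigma[symmetric]) (auto simp: finite_splits)
  also have "\<dots> = series_tensor x (series_tensor y z) h"
    by (simp add: series_tensor_def case_prod_unfold sum_distrib_left)
  finally show "series_tensor (series_tensor x y) z h = series_tensor x (series_tensor y z) h" .
qed

lemma series_tensor_linear_left:
  "series_tensor (\<lambda>w. x w + y w) \<psi> h = series_tensor x \<psi> h + series_tensor y \<psi> h"
  "series_tensor (\<lambda>w. c * x w) \<psi> h = c * series_tensor x \<psi> h"
  by (simp_all add: series_tensor_def case_prod_unfold sum.distrib sum_distrib_left algebra_simps)

lemma series_tensor_one_right: "series_tensor x (coeff (basis_vec [])) = x"
  using series_tensor_basis(1)[of x "[]"] by auto

lemma series_tensor_one_left: "series_tensor (coeff (basis_vec [])) x = x"
proof
  fix h :: "'a list"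
  have "series_tensor (coeff (basis_vec [])) x h
      = (\<Sum>(f, g)\<in>{([], h)}. coeff (basis_vec [] :: 'a fock) f * x g)"
    unfolding series_tensor_def
    by (rule sum.mono_neutral_right[OF finite_splits]) (auto simp: basis_vec.rep_eq split: if_splits)
  then show "series_tensor (coeff (basis_vec [])) x h = x h"
    by (simp add: basis_vec.rep_eq)
qed

lemma tensor_one_right: "x \<otimes>\<^sub>F basis_vec [] = x"
  by (simp add: tensor_def series_tensor_one_right coeff_inverse)

lemma tensor_one_left: "basis_vec [] \<otimes>\<^sub>F x = x"
  by (simp add: tensor_def series_tensor_one_left coeff_inverse)

lemma tensor_assoc:
  assumes "x \<in> F_infty" and "square_summable (series_tensor (coeff y) (coeff z))"
  shows "(x \<otimes>\<^sub>F y) \<otimes>\<^sub>F z = x \<otimes>\<^sub>F (y \<otimes>\<^sub>F z)"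
proof -
  have "series_tensor (coeff (x \<otimes>\<^sub>F y)) (coeff z) = series_tensor (coeff x) (coeff (y \<otimes>\<^sub>F z))"
    by (simp add: coeff_tensor_F_infty assms coeff_tensor series_tensor_assoc)
  then show ?thesis by (simp add: tensor_def)
qed

lemma F_inftyI:
  assumes "\<And>p. p \<in> polynomials \<Longrightarrow> norm (g \<otimes>\<^sub>F p) \<le> C * norm p"
  shows "g \<in> F_infty"
proof -
  have "norm (g \<otimes>\<^sub>F p) \<le> \<bar>C\<bar>" if "p \<in> polynomials" "norm p \<le> 1" for p
  proof -
    have "norm (g \<otimes>\<^sub>F p) \<le> \<bar>C\<bar> * norm p"
      using assms[OF that(1)] by (rule order_trans) (simp add: mult_right_mono)
    also have "\<dots> \<le> \<bar>C\<bar>" using that(2) by (simp add: mult_left_le)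
    finally show ?thesis .
  qed
  then show ?thesis unfolding F_infty_def by (auto intro!: bdd_aboveI)
qed

lemma norm_tensor_F_infty_le:
  "x \<in> F_infty \<Longrightarrow> norm (x \<otimes>\<^sub>F y) \<le> norm_infty x * norm y"
  by (simp add: norm_fock.rep_eq coeff_tensor_F_infty
      square_summable_tensor_F_infty(2)[unfolded norm_fock.rep_eq])

lemma norm_infty_nonneg:
  assumes "x \<in> F_infty"
  shows "0 \<le> norm_infty x"
proof -
  \<comment> \<open>The bound is tested on a vector of positive norm.\<close>
  have "basis_vec [] \<noteq> (0 :: 'a fock)"
  proof
    assume "basis_vec [] = (0 :: 'a fock)"
    then have "coeff (basis_vec [] :: 'a fock) [] = coeff (0 :: 'a fock) []" by simp
    then show False by (simp add: basis_vec.rep_eq zero_fock.rep_eq)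
  qed
  then have "0 < norm (basis_vec [] :: 'a fock)" by simp
  moreover have "0 \<le> norm_infty x * norm (basis_vec [] :: 'a fock)"
    using norm_ge_zero norm_tensor_F_infty_le[OF assms] by (rule order_trans)
  ultimately show ?thesis by (simp add: zero_le_mult_iff)
qed

lemma tensor_add_right:
  "x \<in> F_infty \<Longrightarrow> x \<otimes>\<^sub>F (y + z) = x \<otimes>\<^sub>F y + x \<otimes>\<^sub>F z"
  by (rule fock_eqI)
    (simp add: coeff_tensor_F_infty plus_fock.rep_eq series_tensor_linear_right)

lemma tensor_scaleC_right:
  "x \<in> F_infty \<Longrightarrow> x \<otimes>\<^sub>F (c *\<^sub>C y) = c *\<^sub>C (x \<otimes>\<^sub>F y)"
  by (rule fock_eqI)
    (simp add: coeff_tensor_F_infty scaleC.rep_eq series_tensor_linear_right)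

text \<open>
  The formal product with a sum on the left is the sum of two square summable products, and so is
  itself the coefficient family of a vector.
\<close>

lemma tensor_add_left:
  assumes "x \<in> F_infty" "y \<in> F_infty"
  shows "(x + y) \<otimes>\<^sub>F z = x \<otimes>\<^sub>F z + y \<otimes>\<^sub>F z"
proof -
  have "series_tensor (coeff (x + y)) (coeff z) = coeff (x \<otimes>\<^sub>F z + y \<otimes>\<^sub>F z)"
    by (rule ext)
      (simp add: coeff_tensor_F_infty assms plus_fock.rep_eq series_tensor_linear_left)
  then show ?thesis by (simp add: tensor_def coeff_inverse)
qed

lemma tensor_scaleC_left:
  assumes "x \<in> F_infty"
  shows "(c *\<^sub>C x) \<otimes>\<^sub>F z = c *\<^sub>C (x \<otimes>\<^sub>F z)"
proof -
  have "series_tensor (coeff (c *\<^sub>C x)) (coeff z) = coeff (c *\<^sub>C (x \<otimes>\<^sub>F z))"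
    by (rule ext)
      (simp add: coeff_tensor_F_infty assms scaleC.rep_eq series_tensor_linear_left)
  then show ?thesis by (simp add: tensor_def coeff_inverse)
qed

lemma Phi_in_bounded_operators:
  assumes "x \<in> F_infty"
  shows "Phi x \<in> bounded_operators"
proof -
  have "bounded_linear (Phi x)"
  proof (rule bounded_linear_intro)
    show "norm (Phi x y) \<le> norm y * norm_infty x" for y
      using norm_tensor_F_infty_le[OF assms] by (simp add: Phi_def mult.commute)
  qed (simp_all add: Phi_def assms tensor_add_right tensor_scaleC_right scaleR_eq_scaleC)
  moreover have "Vector_Spaces.linear scaleC scaleC (Phi x)"
    unfolding Vector_Spaces.linear_iff
    by (simp add: Phi_def assms tensor_add_right tensor_scaleC_right fock.vector_space_axioms)
  ultimately show ?thesis by (simp add: bounded_operators_def)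
qed

lemma Phi_algebra_hom:
  "(Phi :: 'a fock \<Rightarrow> _) \<in> algebra_hom F_infty_algebra operator_algebra"
proof -
  have "Phi (x \<otimes>\<^sub>F y) = Phi x \<circ> Phi y" if "x \<in> F_infty" "y \<in> F_infty" for x y :: "'a fock"
    by (simp add: Phi_def fun_eq_iff tensor_assoc that square_summable_tensor_F_infty(1))
  moreover have "Phi (x + y) = (\<lambda>z. Phi x z + Phi y z)"
    if "x \<in> F_infty" "y \<in> F_infty" for x y :: "'a fock"
    by (simp add: Phi_def tensor_add_left that)
  moreover have "Phi (c *\<^sub>C x) = (\<lambda>z. c *\<^sub>C Phi x z)" if "x \<in> F_infty" for c and x :: "'a fock"
    by (simp add: Phi_def tensor_scaleC_left that)
  moreover have "Phi (basis_vec [] :: 'a fock) = id"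
    by (simp add: Phi_def fun_eq_iff tensor_one_left)
  ultimately show ?thesis
    by (simp add: algebra_hom_def ring_hom_def F_infty_algebra_def operator_algebra_def
        Phi_in_bounded_operators)
qed

lemma onorm_Phi:
  assumes "x \<in> F_infty"
  shows "onorm (Phi x) = norm_infty x"
proof (rule antisym)
  show "onorm (Phi x) \<le> norm_infty x"
    by (rule onorm_bound) (auto simp: Phi_def assms norm_infty_nonneg norm_tensor_F_infty_le)
  have bl: "bounded_linear (Phi x)"
    using Phi_in_bounded_operators[OF assms] by (simp add: bounded_operators_def)
  show "norm_infty x \<le> onorm (Phi x)"
    unfolding norm_infty_def
  proof (rule cSup_least)
    have "0 \<in> polynomials" unfolding polynomials_def by (rule fock.span_zero)
    then show "{norm (x \<otimes>\<^sub>F p) |p. p \<in> polynomials \<and> norm p \<le> 1} \<noteq> {}"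
      using norm_zero by fastforce
  next
    fix r assume "r \<in> {norm (x \<otimes>\<^sub>F p) |p. p \<in> polynomials \<and> norm p \<le> 1}"
    then obtain p where p: "r = norm (Phi x p)" "norm p \<le> 1" by (auto simp: Phi_def)
    have "r \<le> onorm (Phi x) * norm p" unfolding p(1) by (rule onorm[OF bl])
    also have "\<dots> \<le> onorm (Phi x)" using p(2) onorm_pos_le[OF bl] by (simp add: mult_left_le)
    finally show "r \<le> onorm (Phi x)" .
  qed
qed

text \<open>
  The symbol of the inverse operator is its value at the unit vector.  Its product with a
  polynomial is always an element of the Fock space, which is what makes the comparison with the
  operator possible before the symbol is known to lie in \<open>F_infty\<close>.
\<close>

lemma inverse_in_F_infty:
  assumes \<psi>: "\<psi> \<in> F_infty" and T: "bounded_linear T"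
    and left: "T \<circ> Phi \<psi> = id" and right: "Phi \<psi> \<circ> T = id"
  obtains \<eta> where "\<eta> \<in> F_infty" "\<eta> \<otimes>\<^sub>F \<psi> = basis_vec []" "\<psi> \<otimes>\<^sub>F \<eta> = basis_vec []"
proof
  define \<eta> where "\<eta> = T (basis_vec [])"
  have rinv: "\<psi> \<otimes>\<^sub>F T y = y" for y
    using fun_cong[OF right, of y] by (simp add: Phi_def)
  have inj: "y = z" if "\<psi> \<otimes>\<^sub>F y = \<psi> \<otimes>\<^sub>F z" for y z
    using fun_cong[OF left, of y] fun_cong[OF left, of z] that by (simp add: Phi_def)
  show one: "\<psi> \<otimes>\<^sub>F \<eta> = basis_vec []" by (simp add: \<eta>_def rinv)
  have eq: "\<eta> \<otimes>\<^sub>F p = T p" if "p \<in> polynomials" for p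
  proof (rule inj)
    have "\<psi> \<otimes>\<^sub>F (\<eta> \<otimes>\<^sub>F p) = (\<psi> \<otimes>\<^sub>F \<eta>) \<otimes>\<^sub>F p"
      by (simp add: tensor_assoc \<psi> square_summable_tensor_polynomial that)
    then show "\<psi> \<otimes>\<^sub>F (\<eta> \<otimes>\<^sub>F p) = \<psi> \<otimes>\<^sub>F T p"
      by (simp add: one rinv tensor_one_left)
  qed
  show \<eta>: "\<eta> \<in> F_infty"
    by (rule F_inftyI[where C = "onorm T"]) (simp add: eq onorm[OF T])
  show "\<eta> \<otimes>\<^sub>F \<psi> = basis_vec []"
  proof (rule inj)
    have "\<psi> \<otimes>\<^sub>F (\<eta> \<otimes>\<^sub>F \<psi>) = (\<psi> \<otimes>\<^sub>F \<eta>) \<otimes>\<^sub>F \<psi>"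
      by (simp add: tensor_assoc \<psi> \<eta> square_summable_tensor_F_infty(1))
    then show "\<psi> \<otimes>\<^sub>F (\<eta> \<otimes>\<^sub>F \<psi>) = \<psi> \<otimes>\<^sub>F basis_vec []"
      by (simp add: one tensor_one_left tensor_one_right)
  qed
qed

lemma Units_iff_Phi_Units:
  assumes \<psi>: "\<psi> \<in> F_infty"
  shows "\<psi> \<in> Units F_infty_algebra \<longleftrightarrow> Phi \<psi> \<in> Units operator_algebra"
proof
  assume "\<psi> \<in> Units F_infty_algebra"
  then obtain \<eta> where \<eta>: "\<eta> \<in> F_infty" "\<eta> \<otimes>\<^sub>F \<psi> = basis_vec []" "\<psi> \<otimes>\<^sub>F \<eta> = basis_vec []"
    by (auto simp: Units_def F_infty_algebra_def)
  have "Phi \<eta> \<circ> Phi \<psi> = id" "Phi \<psi> \<circ> Phi \<eta> = id"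
    using \<psi> \<eta> by (auto simp: Phi_def fun_eq_iff tensor_one_left
        simp flip: tensor_assoc[OF _ square_summable_tensor_F_infty(1)])
  then show "Phi \<psi> \<in> Units operator_algebra"
    using \<psi> \<eta>(1) by (auto simp: Units_def operator_algebra_def Phi_in_bounded_operators)
next
  assume "Phi \<psi> \<in> Units operator_algebra"
  then obtain T where T: "bounded_linear T" "T \<circ> Phi \<psi> = id" "Phi \<psi> \<circ> T = id"
    by (auto simp: Units_def operator_algebra_def bounded_operators_def)
  obtain \<eta> where "\<eta> \<in> F_infty" "\<eta> \<otimes>\<^sub>F \<psi> = basis_vec []" "\<psi> \<otimes>\<^sub>F \<eta> = basis_vec []"
    by (rule inverse_in_F_infty[OF \<psi> T])
  with \<psi> show "\<psi> \<in> Units F_infty_algebra"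
    by (auto simp: Units_def F_infty_algebra_def)
qed

theorem theorem2p2:
  shows "(Phi :: 'n::finite fock \<Rightarrow> 'n fock \<Rightarrow> 'n fock)
           \<in> algebra_hom F_infty_algebra operator_algebra \<and>
         (\<forall>\<psi> \<in> (F_infty :: 'n fock set). onorm (Phi \<psi>) = norm_infty \<psi>) \<and>
         (\<forall>\<psi> \<in> (F_infty :: 'n fock set).
           \<psi> \<in> Units F_infty_algebra \<longleftrightarrow> Phi \<psi> \<in> Units operator_algebra)"
  using Phi_algebra_hom onorm_Phi Units_iff_Phi_Units by blast

end
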